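(* Let $\mathcal{C}\subset\mathbb{R}^n$, with $n=2$ or $n=3$, be a curve polynomially parametrized by $\boldsymbol{x}(t)$. (i) If $\mathcal{C}\subset\mathbb{R}^2$ and $\boldsymbol{x}(t)$ does not have any (real or complex) points with vanishing curvature, then $\boldsymbol{x}(t)$ is an affine image of the rational normal curve in $\mathbb{R}^2$. (ii) If $\mathcal{C}\subset\mathbb{R}^3$ and $\boldsymbol{x}(t)$ does not have any (real or complex) points with vanishing torsion, then $\boldsymbol{x}(t)$ is an affine image of the rational normal curve in $\mathbb{R}^3$.
   Context: A curve in $\mathbb{R}^n$ is polynomially parametrized by $\boldsymbol{x}(t)=(x_1(t),\ldots,x_n(t))$ when all the components $x_i(t)$ are polynomials in $t$ with real coefficients. The rational normal curve in $\mathbb{R}^n$ is the curve parametrized by $(t,t^2,\ldots,t^n)$. An affine image is the image under an affine isomorphism $\boldsymbol{x}\mapsto A\boldsymbol{x}+\boldsymbol{b}$, with $A$ a nonsingular matrix. Curvature (of a planar curve) and torsion (of a space curve) are those of Differential Geometry, given by the usual formulas, whose numerators are $\det(\boldsymbol{x}'(t),\boldsymbol{x}''(t))$ for the curvature when $n=2$ and $\det(\boldsymbol{x}'(t),\boldsymbol{x}''(t),\boldsymbol{x}'''(t))$ for the torsion when $n=3$. "Real or complex points" refers to real or complex values of the parameter $t$. *)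

theory Defs
  imports "HOL-Analysis.Analysis" "HOL-Computational_Algebra.Polynomial"
begin

text \<open>
  A polynomially parametrized curve is the vector of its component polynomials.  Keeping the
  polynomials rather than the function of a real parameter lets the parameter take complex values:
  \<open>curve_deriv k x t\<close> is the \<open>k\<close>-th derivative of the parametrization, for \<open>t\<close> real or complex.
\<close>

definition curve_deriv :: "nat \<Rightarrow> real poly ^ 'n \<Rightarrow> 'a::real_field \<Rightarrow> 'a ^ 'n" where
  "curve_deriv k x t = (\<chi> i. poly (map_poly of_real ((pderiv ^^ k) (x $ i))) t)"

abbreviation curve_point :: "real poly ^ 'n \<Rightarrow> 'a::real_field \<Rightarrow> 'a ^ 'n" where
  "curve_point \<equiv> curve_deriv 0"

definition curvature_numerator :: "real poly ^ 2 \<Rightarrow> 'a::real_field \<Rightarrow> 'a" where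
  "curvature_numerator x t = det (vector [curve_deriv 1 x t, curve_deriv 2 x t])"

definition torsion_numerator :: "real poly ^ 3 \<Rightarrow> 'a::real_field \<Rightarrow> 'a" where
  "torsion_numerator x t = det (vector [curve_deriv 1 x t, curve_deriv 2 x t, curve_deriv 3 x t])"

definition curvature :: "real poly ^ 2 \<Rightarrow> real \<Rightarrow> real" where
  "curvature x t = curvature_numerator x t / norm (curve_deriv 1 x t) ^ 3"

definition torsion :: "real poly ^ 3 \<Rightarrow> real \<Rightarrow> real" where
  "torsion x t = torsion_numerator x t / norm (cross3 (curve_deriv 1 x t) (curve_deriv 2 x t)) ^ 2"

text \<open>
  At a complex parameter the denominators (a power of \<open>x' \<bullet> x'\<close>, respectively the bilinear square
  of \<open>x' \<times> x''\<close>) may vanish although the numerator does not, and division by zero must not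
  count as vanishing curvature: for the parabola \<open>(t, t\<^sup>2)\<close> this happens at \<open>t = \<i>/2\<close>.
  Conversely, points where numerator and denominator both vanish do count, as for the cusp of
  \<open>(t\<^sup>2, t\<^sup>3)\<close>.  Hence vanishing is vanishing of the numerator; where the real quotient is
  defined, this agrees with vanishing of the quotient.
\<close>

definition vanishing_curvature :: "real poly ^ 2 \<Rightarrow> 'a::real_field \<Rightarrow> bool" where
  "vanishing_curvature x t \<longleftrightarrow> curvature_numerator x t = 0"

definition vanishing_torsion :: "real poly ^ 3 \<Rightarrow> 'a::real_field \<Rightarrow> bool" where
  "vanishing_torsion x t \<longleftrightarrow> torsion_numerator x t = 0"

lemma vanishing_curvature_iff:
  assumes "curve_deriv 1 x t \<noteq> 0"
  shows "vanishing_curvature x t \<longleftrightarrow> curvature x t = 0"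
  using assms by (simp add: vanishing_curvature_def curvature_def)

lemma vanishing_torsion_iff:
  assumes "cross3 (curve_deriv 1 x t) (curve_deriv 2 x t) \<noteq> 0"
  shows "vanishing_torsion x t \<longleftrightarrow> torsion x t = 0"
  using assms by (simp add: vanishing_torsion_def torsion_def)

lemma curve_deriv_of_real:
  "curve_deriv k x (of_real t :: 'a::real_field) $ i = of_real (curve_deriv k x t $ i)"
proof -
  have "poly (map_poly of_real p) (of_real t :: 'a) = of_real (poly p t)" for p
    by (induction p) (simp_all add: map_poly_pCons)
  moreover have "map_poly of_real p = p" for p :: "real poly"
    by (simp add: map_poly_idI)
  ultimately show ?thesis by (simp add: curve_deriv_def)
qed

lemma vanishing_curvature_of_real:
  "vanishing_curvature x (complex_of_real t) \<longleftrightarrow> vanishing_curvature x t"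
  unfolding vanishing_curvature_def curvature_numerator_def det_2 vector_2 curve_deriv_of_real
  by (simp flip: of_real_mult of_real_diff)

lemma vanishing_torsion_of_real:
  "vanishing_torsion x (complex_of_real t) \<longleftrightarrow> vanishing_torsion x t"
  unfolding vanishing_torsion_def torsion_numerator_def det_3 vector_3 curve_deriv_of_real
  by (simp flip: of_real_mult of_real_diff of_real_add)

lemma curve_deriv_has_vector_derivative:
  fixes t :: real
  shows "(curve_deriv k x has_vector_derivative curve_deriv (Suc k) x t) (at t)"
proof -
  have "map_poly of_real p = p" for p :: "real poly"
    by (simp add: map_poly_idI)
  then have *: "curve_deriv k x t = (\<chi> i. poly ((pderiv ^^ k) (x $ i)) t)" for k and t :: real
    by (simp add: curve_deriv_def)
  have "((\<lambda>t. \<chi> i. poly ((pderiv ^^ k) (x $ i)) t) has_derivative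
      (\<lambda>h. h *\<^sub>R (\<chi> i. poly ((pderiv ^^ Suc k) (x $ i)) t))) (at t)"
    by (subst has_derivative_componentwise_within)
      (auto simp: Basis_vec_def inner_axis mult.commute intro!: poly_DERIV[unfolded has_field_derivative_def, THEN has_derivative_eq_rhs])
  then show ?thesis
    unfolding has_vector_derivative_def * by (simp add: *)
qed

text \<open>
  The index type is meant to be a numeral type, where \<open>vector\<close> lists the components
  \<open>1, \<dots>, CARD('n)\<close>.
\<close>

definition rational_normal_curve :: "real \<Rightarrow> real ^ 'n::{finite,comm_ring_1}" where
  "rational_normal_curve t = vector (map (\<lambda>k. t ^ k) [1..<Suc CARD('n)])"

lemma rational_normal_curve_2: "(rational_normal_curve t :: real ^ 2) = vector [t, t\<^sup>2]"
  by (simp add: rational_normal_curve_def numeral_eq_Suc upt_rec)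

lemma rational_normal_curve_3: "(rational_normal_curve t :: real ^ 3) = vector [t, t\<^sup>2, t ^ 3]"
  by (simp add: rational_normal_curve_def numeral_eq_Suc upt_rec)

definition affine_image :: "(real \<Rightarrow> real ^ 'n) \<Rightarrow> (real \<Rightarrow> real ^ 'n) \<Rightarrow> bool" where
  "affine_image f g \<longleftrightarrow> (\<exists>(A :: real ^ 'n ^ 'n) b. invertible A \<and> (\<forall>t. f t = A *v g t + b))"

text \<open>The relation is between parametrizations; it implies the one between point sets.\<close>

lemma affine_image_range:
  assumes "affine_image f g"
  shows "\<exists>(A :: real ^ 'n ^ 'n) b. invertible A \<and> range f = (\<lambda>v. A *v v + b) ` range g"
  using assms unfolding affine_image_def by (metis (no_types, lifting) image_cong image_image)

end

theory Submission
  imports Defs "HOL-Computational_Algebra.Fundamental_Theorem_Algebra"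
begin

text \<open>
  The numerators of curvature and torsion are polynomials in \<open>t\<close>, so if they have no complex root
  they are nonzero constants, by the fundamental theorem of algebra.  Both are Wronskians of three
  polynomials: of the components \<open>y\<^sub>1', y\<^sub>2', y\<^sub>3'\<close> of \<open>y'\<close> for the torsion, and of
  \<open>1, x\<^sub>1, x\<^sub>2\<close> for the curvature, because \<open>x\<^sub>1' x\<^sub>2'' - x\<^sub>1'' x\<^sub>2'\<close> is the Wronskian determinant of
  \<open>1, x\<^sub>1, x\<^sub>2\<close> expanded along the column \<open>(1, 0, 0)\<close>.

  The heart of the matter is that three polynomials whose Wronskian is a nonzero constant have
  degree at most two (\<open>wronskian3_constant_degree_le_2\<close>).  Subtracting multiples of one of them from
  another does not change the Wronskian, so their degrees \<open>l, m, n\<close> may be taken pairwise distinct.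
  Then the Wronskian has degree exactly \<open>l + m + n - 3\<close>: its top coefficient is the product of
  the leading coefficients and the Vandermonde determinant of \<open>l, m, n\<close>.  For a constant
  Wronskian this forces \<open>l + m + n = 3\<close>, that is, \<open>{l, m, n} = {0, 1, 2}\<close>.

  Hence \<open>x\<close> has components of degree at most two and \<open>y\<close> has components of degree at most three, so
  that each is the image of the rational normal curve under the affine map given by the
  coefficients.  The linear part is nonsingular because, up to a nonzero factor, its determinant is the
  value of the numerator at \<open>t = 0\<close>.
\<close>

section \<open>Wronskians of three polynomials\<close>

definition wronskian3 :: "'a::idom poly \<Rightarrow> 'a poly \<Rightarrow> 'a poly \<Rightarrow> 'a poly" where
  "wronskian3 p q r =
     p * (pderiv q * pderiv (pderiv r) - pderiv (pderiv q) * pderiv r)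
     - pderiv p * (q * pderiv (pderiv r) - pderiv (pderiv q) * r)
     + pderiv (pderiv p) * (q * pderiv r - pderiv q * r)"

lemma wronskian3_swap12: "wronskian3 q p r = - wronskian3 p q r"
  by (simp add: wronskian3_def algebra_simps)

lemma wronskian3_swap23: "wronskian3 p r q = - wronskian3 p q r"
  by (simp add: wronskian3_def algebra_simps)

lemma wronskian3_diff_smult: "wronskian3 p (q - smult a p) r = wronskian3 p q r"
  by (simp add: wronskian3_def pderiv_diff pderiv_smult algebra_simps)

lemma wronskian3_1: "wronskian3 1 p q = pderiv p * pderiv (pderiv q) - pderiv (pderiv p) * pderiv q"
  by (simp add: wronskian3_def)

text \<open>
  Leading-coefficient multiplicativity with degree bounds in place of degrees; unlike
  \<open>coeff_mult_degree_sum\<close>, it applies to derivatives without computing their degrees.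
\<close>

lemma coeff_mult_degree_bounds:
  fixes p q :: "'a::comm_semiring_0 poly"
  assumes "degree p \<le> m" and "degree q \<le> n"
  shows "coeff (p * q) (m + n) = coeff p m * coeff q n"
proof -
  have "coeff p i * coeff q (m + n - i) = (if i = m then coeff p m * coeff q n else 0)" for i
  proof (cases i m rule: linorder_cases)
    case less
    then have "degree q < m + n - i" using assms by linarith
    then show ?thesis using less by (simp add: coeff_eq_0)
  next
    case greater
    then show ?thesis using assms by (simp add: coeff_eq_0)
  qed simp
  then show ?thesis by (simp add: coeff_mult)
qed

text \<open>
  The Euler operator \<open>X d/dX\<close> multiplies the coefficient of \<open>X\<^sup>n\<close> by \<open>n\<close>, which is what turns
  the top coefficient of a Wronskian into a Vandermonde determinant.
\<close>

definition euler_op :: "'a::idom poly \<Rightarrow> 'a poly" where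
  "euler_op p = pCons 0 (pderiv p)"

lemma coeff_euler_op: "coeff (euler_op p) n = of_nat n * coeff p n"
  by (cases n) (simp_all add: euler_op_def coeff_pderiv)

lemma degree_euler_op_le: "degree (euler_op p) \<le> degree p"
  by (rule degree_le) (simp add: coeff_euler_op coeff_eq_0)

lemma euler_op_conv: "euler_op p = [:0, 1:] * pderiv p"
  by (simp add: euler_op_def)

lemma euler_op_twice: "euler_op (euler_op p) = [:0, 1:] * pderiv p + [:0, 1:]\<^sup>2 * pderiv (pderiv p)"
proof -
  have "pderiv ([:0, 1:] * pderiv p) = pderiv p + [:0, 1:] * pderiv (pderiv p)"
    by (simp add: pderiv_pCons)
  then show ?thesis
    by (simp only: euler_op_conv) (simp only: algebra_simps power2_eq_square)
qed

text \<open>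
  By \<open>euler_op_twice\<close>, the second row \<open>X p'\<close> and the third row \<open>X\<^sup>2 p''\<close> of the Wronskian matrix,
  rescaled by \<open>X\<close> and \<open>X\<^sup>2\<close>, may be replaced by the first and second iterate of the Euler operator.
\<close>

lemma wronskian3_euler_op:
  "[:0, 1:] ^ 3 * wronskian3 p q r =
     p * (euler_op q * euler_op (euler_op r) - euler_op (euler_op q) * euler_op r)
     - euler_op p * (q * euler_op (euler_op r) - euler_op (euler_op q) * r)
     + euler_op (euler_op p) * (q * euler_op r - euler_op q * r)"
proof -
  define X where "X = [:0, 1 :: 'a:]"
  have "euler_op p = X * pderiv p"
    and "euler_op (euler_op p) = X * pderiv p + X\<^sup>2 * pderiv (pderiv p)" for p
    unfolding X_def by (rule euler_op_conv euler_op_twice)+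
  then show ?thesis
    unfolding wronskian3_def X_def[symmetric]
    by (simp add: algebra_simps power2_eq_square power3_eq_cube)
qed

lemma coeff_wronskian3_Vandermonde:
  fixes p q r :: "'a::idom poly"
  defines "l \<equiv> degree p" and "m \<equiv> degree q" and "n \<equiv> degree r"
  shows "coeff ([:0, 1:] ^ 3 * wronskian3 p q r) (l + m + n) =
     lead_coeff p * lead_coeff q * lead_coeff r *
     ((of_nat m - of_nat l) * (of_nat n - of_nat l) * (of_nat n - of_nat m))"
proof -
  have top: "coeff (p' * (q' * r')) (l + m + n) = coeff p' l * (coeff q' m * coeff r' n)"
    if "degree p' \<le> l" "degree q' \<le> m" "degree r' \<le> n" for p' q' r' :: "'a poly"
  proof -
    have "degree (q' * r') \<le> m + n"
      using degree_mult_le[of q' r'] that by linarith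
    then show ?thesis
      using coeff_mult_degree_bounds[of p' l "q' * r'" "m + n"]
        coeff_mult_degree_bounds[of q' m r' n] that by (simp add: add.assoc)
  qed
  have deg: "degree (euler_op f) \<le> degree f" "degree (euler_op (euler_op f)) \<le> degree f"
    for f :: "'a poly"
    using degree_euler_op_le order_trans by blast+
  show ?thesis
    unfolding wronskian3_euler_op right_diff_distrib coeff_diff coeff_add
    by (simp add: top[unfolded l_def m_def n_def] deg coeff_euler_op l_def m_def n_def) (simp add: algebra_simps)
qed

lemma degree_sum_eq_3_if_wronskian3_constant:
  fixes p q r :: "'a::field_char_0 poly"
  assumes W: "wronskian3 p q r = [:c:]" "c \<noteq> 0"
    and distinct: "degree p \<noteq> degree q" "degree q \<noteq> degree r" "degree p \<noteq> degree r"
  shows "degree p + degree q + degree r = 3"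
proof -
  have "p \<noteq> 0" "q \<noteq> 0" "r \<noteq> 0"
    using W by (auto simp: wronskian3_def)
  then have "coeff ([:0, 1:] ^ 3 * wronskian3 p q r) (degree p + degree q + degree r) \<noteq> 0"
    using distinct unfolding coeff_wronskian3_Vandermonde by auto
  moreover have "[:0, 1:] ^ 3 * wronskian3 p q r = monom c 3"
    by (simp add: W monom_altdef)
  ultimately show ?thesis by (simp split: if_splits)
qed

lemma wronskian3_constant_degree_le_2:
  fixes p q r :: "'a::field_char_0 poly"
  assumes "wronskian3 p q r = [:c:]" and "c \<noteq> 0"
  shows "degree p \<le> 2 \<and> degree q \<le> 2 \<and> degree r \<le> 2"
  using assms
proof (induction "degree p + degree q + degree r" arbitrary: p q r c rule: less_induct)
  case less
  \<comment> \<open>Stated for arbitrary polynomials with the same sum of degrees, so that it can be used for each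
      of the three pairs after permuting \<open>p, q, r\<close>.\<close>
  have equal_degrees: "degree f \<le> 2 \<and> degree g \<le> 2 \<and> degree h \<le> 2"
    if "degree f = degree g" and W: "wronskian3 f g h = [:a:]" "a \<noteq> 0"
      and sum: "degree f + degree g + degree h = degree p + degree q + degree r"
    for f g h :: "'a poly" and a
  proof -
    have "degree f > 0"
    proof (rule ccontr)
      assume "\<not> degree f > 0"
      then have "pderiv f = 0" "pderiv g = 0"
        using \<open>degree f = degree g\<close> by (simp_all add: pderiv_eq_0_iff)
      then show False using W by (simp add: wronskian3_def)
    qed
    define k where "k = lead_coeff g / lead_coeff f"
    define g' where "g' = g - smult k f"
    have "degree g' \<le> degree f"
      unfolding g'_def using \<open>degree f = degree g\<close> by (intro degree_diff_le) auto
    moreover have "coeff g' (degree f) = 0"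
      using \<open>degree f > 0\<close> \<open>degree f = degree g\<close> by (simp add: g'_def k_def) (metis degree_0 less_irrefl leading_coeff_0_iff)
    ultimately have "degree g' < degree f"
      using \<open>degree f > 0\<close> by (metis degree_0 leading_coeff_0_iff order_le_less)
    then have "degree f + degree g' + degree h < degree p + degree q + degree r"
      using sum \<open>degree f = degree g\<close> by linarith
    moreover have "wronskian3 f g' h = [:a:]"
      using W by (simp add: g'_def wronskian3_diff_smult)
    ultimately have "degree f \<le> 2 \<and> degree g' \<le> 2 \<and> degree h \<le> 2"
      using less.hyps W by blast
    then show ?thesis using \<open>degree f = degree g\<close> by simp
  qed
  consider "degree p = degree q" | "degree q = degree r" | "degree p = degree r"
    | "degree p \<noteq> degree q" "degree q \<noteq> degree r" "degree p \<noteq> degree r" by blast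
  then show ?case
  proof cases
    case 1
    then show ?thesis using equal_degrees less.prems by blast
  next
    case 2
    have "wronskian3 q r p = [:c:]"
      using less.prems by (simp add: wronskian3_swap23[of q r p] wronskian3_swap12[of q p r])
    then show ?thesis using equal_degrees[of q r p c] 2 less.prems by simp
  next
    case 3
    have "wronskian3 p r q = [:- c:]"
      using less.prems by (simp add: wronskian3_swap23[of p r q])
    then show ?thesis using equal_degrees[of p r q "- c"] 3 less.prems by simp
  next
    case 4
    then show ?thesis
      using degree_sum_eq_3_if_wronskian3_constant[OF less.prems] by linarith
  qed
qed

section \<open>Real polynomials at complex arguments\<close>

lemma poly_of_real_add:
  "poly (map_poly of_real (p + q)) t = poly (map_poly of_real p) t + poly (map_poly of_real q) t"
  for t :: "'a::real_field"
proof -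
  have "map_poly of_real (p + q) = (map_poly of_real p + map_poly of_real q :: 'a poly)"
    by (rule poly_eqI) (simp add: coeff_map_poly)
  then show ?thesis by simp
qed

lemma poly_of_real_diff:
  "poly (map_poly of_real (p - q)) t = poly (map_poly of_real p) t - poly (map_poly of_real q) t"
  for t :: "'a::real_field"
proof -
  have "map_poly of_real (p - q) = (map_poly of_real p - map_poly of_real q :: 'a poly)"
    by (rule poly_eqI) (simp add: coeff_map_poly)
  then show ?thesis by simp
qed

lemma poly_of_real_mult:
  "poly (map_poly of_real (p * q)) t = poly (map_poly of_real p) t * poly (map_poly of_real q) t"
  for t :: "'a::real_field"
proof -
  have "map_poly of_real (p * q) = (map_poly of_real p * map_poly of_real q :: 'a poly)"
    by (rule poly_eqI) (simp add: coeff_map_poly coeff_mult)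
  then show ?thesis by simp
qed

lemma nonzero_constant_if_no_complex_root:
  fixes p :: "real poly"
  assumes "\<And>z::complex. poly (map_poly of_real p) z \<noteq> 0"
  obtains c where "p = [:c:]" and "c \<noteq> 0"
proof -
  have "p \<noteq> 0" using assms by (metis map_poly_0 poly_0)
  have "degree (map_poly complex_of_real p) = 0"
    using fundamental_theorem_of_algebra assms constant_degree by blast
  moreover have "degree (map_poly complex_of_real p) = degree p"
    by (rule map_poly_degree_eq) (simp add: \<open>p \<noteq> 0\<close>)
  ultimately obtain c where "p = [:c:]" by (auto elim: degree_eq_zeroE)
  then show ?thesis using that \<open>p \<noteq> 0\<close> by auto
qed

section \<open>Curvature and torsion as Wronskians\<close>

lemma curvature_numerator_eq_wronskian3:
  "curvature_numerator x t = poly (map_poly of_real (wronskian3 1 (x $ 1) (x $ 2))) t"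
  by (simp add: curvature_numerator_def curve_deriv_def wronskian3_1 det_2 numeral_eq_Suc
      poly_of_real_diff poly_of_real_mult algebra_simps)

lemma torsion_numerator_eq_wronskian3:
  "torsion_numerator y t =
     poly (map_poly of_real (wronskian3 (pderiv (y $ 1)) (pderiv (y $ 2)) (pderiv (y $ 3)))) t"
  by (simp add: torsion_numerator_def curve_deriv_def wronskian3_def det_3 numeral_eq_Suc
      poly_of_real_add poly_of_real_diff poly_of_real_mult algebra_simps)

section \<open>Polynomial curves of low degree\<close>

lemma curve_point_eq_coeff_sum:
  fixes t :: real
  assumes "degree (x $ i) \<le> n"
  shows "curve_point x t $ i = (\<Sum>k\<le>n. coeff (x $ i) k * t ^ k)"
proof -
  have "curve_point x t $ i = poly (x $ i) t"
    by (simp add: curve_deriv_def map_poly_idI)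
  also have "\<dots> = poly (\<Sum>k\<le>n. monom (coeff (x $ i) k) k) t"
    by (simp add: poly_as_sum_of_monoms'[OF assms])
  finally show ?thesis by (simp add: poly_sum poly_monom)
qed

lemma affine_image_rational_normal_curve_2:
  fixes x :: "real poly ^ 2"
  assumes deg: "\<And>i. degree (x $ i) \<le> 2" and "curvature_numerator x (0::real) \<noteq> 0"
  shows "affine_image (curve_point x) rational_normal_curve"
proof -
  define A :: "real ^ 2 ^ 2" where "A = (\<chi> i. vector [coeff (x $ i) 1, coeff (x $ i) 2])"
  have "curvature_numerator x (0::real) = 2 * det A"
    by (simp add: curvature_numerator_def curve_deriv_def A_def det_2 map_poly_idI
        poly_0_coeff_0 coeff_pderiv numeral_eq_Suc algebra_simps)
  then have "invertible A" using assms(2) by (simp add: invertible_det_nz)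
  moreover have "curve_point x t = A *v rational_normal_curve t + (\<chi> i. coeff (x $ i) 0)" for t
    by (simp add: vec_eq_iff curve_point_eq_coeff_sum[OF deg] A_def matrix_vector_mult_def
        rational_normal_curve_2 sum_2 numeral_eq_Suc)
  ultimately show ?thesis unfolding affine_image_def by blast
qed

lemma affine_image_rational_normal_curve_3:
  fixes y :: "real poly ^ 3"
  assumes deg: "\<And>i. degree (y $ i) \<le> 3" and "torsion_numerator y (0::real) \<noteq> 0"
  shows "affine_image (curve_point y) rational_normal_curve"
proof -
  define A :: "real ^ 3 ^ 3"
    where "A = (\<chi> i. vector [coeff (y $ i) 1, coeff (y $ i) 2, coeff (y $ i) 3])"
  have "torsion_numerator y (0::real) = 12 * det A"
    by (simp add: torsion_numerator_def curve_deriv_def A_def det_3 map_poly_idI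
        poly_0_coeff_0 coeff_pderiv eval_nat_numeral algebra_simps)
  then have "invertible A" using assms(2) by (simp add: invertible_det_nz)
  moreover have "curve_point y t = A *v rational_normal_curve t + (\<chi> i. coeff (y $ i) 0)" for t
    by (simp add: vec_eq_iff curve_point_eq_coeff_sum[OF deg] A_def matrix_vector_mult_def
        rational_normal_curve_3 sum_3 eval_nat_numeral)
  ultimately show ?thesis unfolding affine_image_def by blast
qed

lemma affine_image_if_curvature_nonvanishing:
  fixes x :: "real poly ^ 2"
  assumes "\<And>t::complex. \<not> vanishing_curvature x t"
  shows "affine_image (curve_point x) rational_normal_curve"
proof (rule affine_image_rational_normal_curve_2)
  obtain c where "wronskian3 1 (x $ 1) (x $ 2) = [:c:]" "c \<noteq> 0"
    using assms nonzero_constant_if_no_complex_root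
    unfolding vanishing_curvature_def curvature_numerator_eq_wronskian3 by blast
  then have "degree (x $ 1) \<le> 2 \<and> degree (x $ 2) \<le> 2"
    using wronskian3_constant_degree_le_2 by blast
  then show "degree (x $ i) \<le> 2" for i
    using exhaust_2[of i] by auto
  show "curvature_numerator x (0::real) \<noteq> 0"
    using assms[of "of_real 0"] unfolding vanishing_curvature_of_real
    by (simp only: vanishing_curvature_def not_False_eq_True)
qed

lemma affine_image_if_torsion_nonvanishing:
  fixes y :: "real poly ^ 3"
  assumes "\<And>t::complex. \<not> vanishing_torsion y t"
  shows "affine_image (curve_point y) rational_normal_curve"
proof (rule affine_image_rational_normal_curve_3)
  obtain c where
    "wronskian3 (pderiv (y $ 1)) (pderiv (y $ 2)) (pderiv (y $ 3)) = [:c:]" "c \<noteq> 0"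
    using assms nonzero_constant_if_no_complex_root
    unfolding vanishing_torsion_def torsion_numerator_eq_wronskian3 by blast
  then have "degree (pderiv (y $ 1)) \<le> 2 \<and> degree (pderiv (y $ 2)) \<le> 2 \<and> degree (pderiv (y $ 3)) \<le> 2"
    by (rule wronskian3_constant_degree_le_2)
  then show "degree (y $ i) \<le> 3" for i
    using exhaust_3[of i] by (auto simp: degree_pderiv)
  show "torsion_numerator y (0::real) \<noteq> 0"
    using assms[of "of_real 0"] unfolding vanishing_torsion_of_real
    by (simp only: vanishing_torsion_def not_False_eq_True)
qed

theorem theorem9:
  fixes x :: "real poly ^ 2" and y :: "real poly ^ 3"
  shows "((\<forall>t::complex. \<not> vanishing_curvature x t) \<longrightarrow>
            affine_image (curve_point x) rational_normal_curve) \<and>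
         ((\<forall>t::complex. \<not> vanishing_torsion y t) \<longrightarrow>
            affine_image (curve_point y) rational_normal_curve)"
  by (simp add: affine_image_if_curvature_nonvanishing affine_image_if_torsion_nonvanishing)

end
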